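(* Let $\mathcal H$ be a Hilbert space, let $H_0$ be a densely defined symmetric operator in $\mathcal H$, and let $(\Omega,\mathcal G,\mathcal G,F,\omega)$ be a boundary system for $H_0$, where $\Omega$ is the standard skew-symmetric form (restricted to $G(H_0^* )$) and $\omega$ is the standard skew-symmetric form on $\mathcal G\oplus\mathcal G$. Write $F(x,H_0^*x)=(F_1(x),F_2(x))$ for $x\in D(H_0^* )$, with $F_1,F_2\colon D(H_0^* )\to\mathcal G$. Then an operator $H\subseteq H_0^*$ is self-adjoint if and only if there exist a closed subspace $X\subseteq\mathcal G$ and a self-adjoint operator $L$ in $X$ such that \[ D(H)=\{x\in D(H_0^* ) : F_1(x)\in D(L),\ L F_1(x)=Q F_2(x)\}, \] where $Q\colon\mathcal G\to X$ is the orthogonal projection.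
   Context: All vector spaces are over $\mathbb K\in\{\mathbb R,\mathbb C\}$; inner products $(\cdot\mid\cdot)$ and sesquilinear forms are linear in the first and conjugate linear in the second argument. Operators are linear; $D(A)$ is the domain and $G(A)=\{(x,Ax): x\in D(A)\}$ the graph of $A$; $A\subseteq B$ means $G(A)\subseteq G(B)$. An operator $H_0$ is symmetric if $H_0\subseteq H_0^*$ and self-adjoint if $H_0=H_0^*$. For a Hilbert space $\mathcal K$, the standard skew-symmetric form on $\mathcal K\oplus\mathcal K$ is $((x,y),(u,v))\mapsto (x\mid v)_{\mathcal K}-(y\mid u)_{\mathcal K}$. A boundary system $(\Omega,\mathcal G_1,\mathcal G_2,F,\omega)$ for $H_0$ consists of a sesquilinear form $\Omega$ on $G(H_0^* )$, two Hilbert spaces $\mathcal G_1,\mathcal G_2$, a linear and surjective mapping $F\colon G(H_0^* )\to\mathcal G_1\oplus\mathcal G_2$ (no continuity is required) and a sesquilinear form $\omega$ on $\mathcal G_1\oplus\mathcal G_2$ such that \[ \Omega((x,H_0^*x),(y,H_0^*y))=\omega(F(x,H_0^*x),F(y,H_0^*y))\qquad (x,y\in D(H_0^* )). \] Here $\mathcal G_1=\mathcal G_2=\mathcal G$. *)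

theory Defs
  imports "HOL-Analysis.Analysis"
begin

section \<open>The scalar field: the reals or the complex numbers\<close>

text \<open>
  By \<open>real_or_complex_cases\<close> below, the models of this class are, up to isomorphism,
  exactly the real and the complex numbers with the usual conjugation.
\<close>

class real_or_complex = real_normed_field +
  fixes conj :: "'a \<Rightarrow> 'a"
  assumes conj_add: "conj (x + y) = conj x + conj y"
    and mult_conj_scaleR: "x * conj x = (norm x)\<^sup>2 *\<^sub>R 1"

instantiation real :: real_or_complex
begin
definition conj_real :: "real \<Rightarrow> real" where "conj_real x = x"
instance by standard (simp_all add: conj_real_def power2_eq_square)
end

instantiation complex :: real_or_complex
begin
definition conj_complex :: "complex \<Rightarrow> complex" where "conj_complex = cnj"
instance by standard
    (simp_all add: conj_complex_def scaleR_conv_of_real flip: complex_norm_square)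
end

lemma mult_conj: "x * conj x = of_real ((norm x)\<^sup>2)" for x :: "'k::real_or_complex"
  by (simp add: mult_conj_scaleR of_real_def)

lemma real_or_complex_quadratic:
  fixes z :: "'k::real_or_complex"
  obtains a r :: real where "(z - of_real a)\<^sup>2 = of_real r" "conj z = of_real (2 * a) - z"
proof -
  have c1: "conj (1::'k) = 1"
    using mult_conj[of "1::'k"] by simp
  have "(1 + z) * (1 + conj z) = of_real ((norm (1 + z))\<^sup>2)"
    using mult_conj[of "1 + z"] by (simp add: conj_add c1)
  then have sum: "z + conj z = of_real ((norm (1 + z))\<^sup>2 - 1 - (norm z)\<^sup>2)"
    using mult_conj[of z] by (simp add: algebra_simps)
  define a where "a = ((norm (1 + z))\<^sup>2 - 1 - (norm z)\<^sup>2) / 2"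
  then have "2 * a = (norm (1 + z))\<^sup>2 - 1 - (norm z)\<^sup>2" by simp
  with sum have "z + conj z = of_real (2 * a)" by simp
  then have cz: "conj z = of_real (2 * a) - z"
    by (metis add_diff_cancel_left')
  have "z * (of_real (2 * a) - z) = of_real ((norm z)\<^sup>2)"
    using mult_conj[of z] cz by simp
  then have "(z - of_real a)\<^sup>2 = of_real (a\<^sup>2 - (norm z)\<^sup>2)"
    by (simp add: power2_eq_square algebra_simps)
  with cz show ?thesis using that by blast
qed

lemma real_or_complex_cases:
  obtains (real) "\<And>z::'k::real_or_complex. z \<in> \<real>" "\<And>z::'k. conj z = z"
  | (complex) i :: "'k::real_or_complex" where "i * i = -1"
      "\<And>z. \<exists>a b. z = of_real a + of_real b * i \<and> conj z = of_real a - of_real b * i"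
proof (cases "\<forall>z::'k. z \<in> \<real>")
  case True
  have "conj z = z" for z :: 'k
  proof (cases "z = 0")
    case True
    then show ?thesis using conj_add[of "0::'k" 0] by simp
  next
    case False
    from \<open>\<forall>z::'k. z \<in> \<real>\<close> obtain r where "z = of_real r" by (auto elim: Reals_cases)
    with False mult_conj[of z] show ?thesis by (simp add: power2_eq_square)
  qed
  with True real show thesis by blast
next
  case False
  have root: "\<exists>b i. z - of_real a = of_real b * i \<and> i * i = -1"
    if z: "(z - of_real a)\<^sup>2 = of_real r" "z \<notin> \<real>" for z :: 'k and a r
  proof -
    have "r < 0"
    proof (rule ccontr)
      assume "\<not> r < 0"
      then have "(z - of_real a)\<^sup>2 = (of_real (sqrt r))\<^sup>2"
        using z by (simp flip: of_real_power)
      then have "z - of_real a = of_real (sqrt r) \<or> z - of_real a = - of_real (sqrt r)"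
        by (simp add: power2_eq_iff)
      then have "z = of_real (a + sqrt r) \<or> z = of_real (a - sqrt r)"
        by (auto simp: algebra_simps)
      with z show False by auto
    qed
    define b where "b = sqrt (- r)"
    define i where "i = (z - of_real a) / of_real b"
    have b: "b \<noteq> 0" "b * b = - r" using \<open>r < 0\<close> by (simp_all add: b_def)
    have "i * i = (z - of_real a)\<^sup>2 / of_real (b * b)"
      by (simp add: i_def power2_eq_square)
    also have "\<dots> = -1" using b z \<open>r < 0\<close> by simp
    finally show ?thesis using b by (intro exI[of _ b] exI[of _ i]) (simp add: i_def)
  qed
  from False obtain z0 :: 'k where "z0 \<notin> \<real>" by blast
  with root real_or_complex_quadratic[of z0] obtain i :: 'k where i: "i * i = -1" by metis
  have "\<exists>a b. z = of_real a + of_real b * i \<and> conj z = of_real a - of_real b * i" for z :: 'k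
  proof -
    obtain a r where ar: "(z - of_real a)\<^sup>2 = of_real r" "conj z = of_real (2 * a) - z"
      using real_or_complex_quadratic by blast
    have "\<exists>b. z = of_real a + of_real b * i"
    proof (cases "z \<in> \<real>")
      case True
      then obtain s where s: "z = of_real s" by (auto elim: Reals_cases)
      from mult_conj[of z] ar(2) s have "s * (2 * a - s) = s * s"
        by (simp add: power2_eq_square flip: of_real_mult of_real_diff)
      then have "s = 0 \<or> s = a" by auto
      moreover have "s = a" if "s = 0"
        using ar(2) s that conj_add[of "0::'k" 0] by simp
      ultimately show ?thesis using s by (intro exI[of _ 0]) auto
    next
      case False
      from root[OF ar(1) False] obtain b j where bj: "z - of_real a = of_real b * j" "j * j = -1"
        by blast
      have "(j - i) * (j + i) = 0" using bj i by (simp add: algebra_simps)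
      then have "j = i \<or> j = - i" by (auto simp: eq_neg_iff_add_eq_0)
      then show ?thesis
      proof
        assume "j = i"
        then show ?thesis using bj by (intro exI[of _ b]) (simp add: algebra_simps)
      next
        assume "j = - i"
        then show ?thesis using bj by (intro exI[of _ "- b"]) (simp add: algebra_simps)
      qed
    qed
    then show ?thesis using ar(2) by fastforce
  qed
  with i complex show thesis by blast
qed


section \<open>Hilbert spaces and sesquilinear forms\<close>

text \<open>
  The topology is that of the type class; \<open>scale_of_real\<close> and \<open>norm_eq\<close> tie the type
  class structure to the scalar multiplication and the inner product.
\<close>

locale hilbert_space = vector_space scale
  for scale :: "'k::real_or_complex \<Rightarrow> 'v::banach \<Rightarrow> 'v" +
  fixes ip :: "'v \<Rightarrow> 'v \<Rightarrow> 'k"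
  assumes scale_of_real: "scale (of_real r) x = r *\<^sub>R x"
    and ip_add_left: "ip (x + y) z = ip x z + ip y z"
    and ip_scale_left: "ip (scale c x) z = c * ip x z"
    and ip_commute: "ip x y = conj (ip y x)"
    and norm_eq: "of_real ((norm x)\<^sup>2) = ip x x"

lemma hilbert_space_real:
  "hilbert_space scaleR (inner :: 'v::{real_inner,banach} \<Rightarrow> 'v \<Rightarrow> real)"
  by unfold_locales
    (simp_all add: conj_real_def inner_commute inner_add_left power2_norm_eq_inner algebra_simps)

lemma hilbert_space_complex:
  "hilbert_space (*) (\<lambda>x y :: complex. x * cnj y)"
  by unfold_locales
    (simp_all add: conj_complex_def scaleR_conv_of_real algebra_simps flip: complex_norm_square)

definition sesquilinear_form_on ::
  "('k::real_or_complex \<Rightarrow> 'v::ab_group_add \<Rightarrow> 'v) \<Rightarrow> 'v set \<Rightarrow> ('v \<Rightarrow> 'v \<Rightarrow> 'k) \<Rightarrow> bool" where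
  "sesquilinear_form_on s S B \<longleftrightarrow>
     (\<forall>x\<in>S. \<forall>y\<in>S. \<forall>z\<in>S. B (x + y) z = B x z + B y z \<and> B z (x + y) = B z x + B z y) \<and>
     (\<forall>c. \<forall>x\<in>S. \<forall>y\<in>S. B (s c x) y = c * B x y \<and> B x (s c y) = conj c * B x y)"

definition standard_skew_form ::
  "('v \<Rightarrow> 'v \<Rightarrow> 'k::ab_group_add) \<Rightarrow> 'v \<times> 'v \<Rightarrow> 'v \<times> 'v \<Rightarrow> 'k" where
  "standard_skew_form ip = (\<lambda>(x, y) (u, v). ip x v - ip y u)"

definition orthogonal_projection ::
  "('v::ab_group_add \<Rightarrow> 'v \<Rightarrow> 'k::zero) \<Rightarrow> 'v set \<Rightarrow> 'v \<Rightarrow> 'v" where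
  "orthogonal_projection ip X y = (THE p. p \<in> X \<and> (\<forall>x\<in>X. ip (y - p) x = 0))"


section \<open>Operators\<close>

text \<open>
  An operator \<open>A\<close> is identified with its graph, so that its domain is \<open>Domain A\<close> and
  \<open>A \<subseteq> B\<close> is the usual extension relation. The set \<open>X\<close> is the subspace in which the
  operator acts; operators in the whole space are those with \<open>X = UNIV\<close>.
\<close>

definition is_operator_in ::
  "('k::real_or_complex \<Rightarrow> 'v::ab_group_add \<Rightarrow> 'v) \<Rightarrow> 'v set \<Rightarrow> ('v \<times> 'v) set \<Rightarrow> bool" where
  "is_operator_in s X A \<longleftrightarrow>
     A \<subseteq> X \<times> X \<and> module.subspace (module_prod.scale s s) A \<and> single_valued A"

definition op_apply :: "('v \<times> 'w) set \<Rightarrow> 'v \<Rightarrow> 'w" where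
  "op_apply A x = (THE y. (x, y) \<in> A)"

definition densely_defined_in :: "'v::topological_space set \<Rightarrow> ('v \<times> 'v) set \<Rightarrow> bool" where
  "densely_defined_in X A \<longleftrightarrow> X \<subseteq> closure (Domain A)"

text \<open>The graph of the adjoint in \<open>X\<close>; it is single-valued if \<open>A\<close> is densely defined in \<open>X\<close>.\<close>

definition adjoint_in ::
  "('v \<Rightarrow> 'v \<Rightarrow> 'k) \<Rightarrow> 'v set \<Rightarrow> ('v \<times> 'v) set \<Rightarrow> ('v \<times> 'v) set" where
  "adjoint_in ip X A = {(u, v) \<in> X \<times> X. \<forall>(x, y)\<in>A. ip y u = ip x v}"

definition symmetric_in ::
  "('v \<Rightarrow> 'v \<Rightarrow> 'k) \<Rightarrow> 'v set \<Rightarrow> ('v \<times> 'v) set \<Rightarrow> bool" where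
  "symmetric_in ip X A \<longleftrightarrow> A \<subseteq> adjoint_in ip X A"

definition self_adjoint_in ::
  "('v::topological_space \<Rightarrow> 'v \<Rightarrow> 'k) \<Rightarrow> 'v set \<Rightarrow> ('v \<times> 'v) set \<Rightarrow> bool" where
  "self_adjoint_in ip X A \<longleftrightarrow> densely_defined_in X A \<and> A = adjoint_in ip X A"

abbreviation "is_operator s \<equiv> is_operator_in s UNIV"
abbreviation "densely_defined \<equiv> densely_defined_in UNIV"
abbreviation "adjoint_op ip \<equiv> adjoint_in ip UNIV"
abbreviation "symmetric_op ip \<equiv> symmetric_in ip UNIV"
abbreviation "self_adjoint ip \<equiv> self_adjoint_in ip UNIV"


section \<open>Boundary systems\<close>

locale boundary_system =
  H: hilbert_space sH ipH + G1: hilbert_space s1 ip1 + G2: hilbert_space s2 ip2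
  for sH :: "'k::real_or_complex \<Rightarrow> 'h::banach \<Rightarrow> 'h" and ipH :: "'h \<Rightarrow> 'h \<Rightarrow> 'k"
    and s1 :: "'k \<Rightarrow> 'g1::banach \<Rightarrow> 'g1" and ip1 :: "'g1 \<Rightarrow> 'g1 \<Rightarrow> 'k"
    and s2 :: "'k \<Rightarrow> 'g2::banach \<Rightarrow> 'g2" and ip2 :: "'g2 \<Rightarrow> 'g2 \<Rightarrow> 'k" +
  fixes H0 :: "('h \<times> 'h) set"
    and \<Omega> :: "'h \<times> 'h \<Rightarrow> 'h \<times> 'h \<Rightarrow> 'k"
    and F :: "'h \<times> 'h \<Rightarrow> 'g1 \<times> 'g2"
    and \<omega> :: "'g1 \<times> 'g2 \<Rightarrow> 'g1 \<times> 'g2 \<Rightarrow> 'k"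
  assumes sesquilinear_\<Omega>:
      "sesquilinear_form_on (module_prod.scale sH sH) (adjoint_op ipH H0) \<Omega>"
    and F_add: "p \<in> adjoint_op ipH H0 \<Longrightarrow> q \<in> adjoint_op ipH H0 \<Longrightarrow> F (p + q) = F p + F q"
    and F_scale:
      "p \<in> adjoint_op ipH H0 \<Longrightarrow> F (module_prod.scale sH sH c p) = module_prod.scale s1 s2 c (F p)"
    and F_surj: "F ` adjoint_op ipH H0 = UNIV"
    and sesquilinear_\<omega>: "sesquilinear_form_on (module_prod.scale s1 s2) UNIV \<omega>"
    and \<Omega>_eq: "p \<in> adjoint_op ipH H0 \<Longrightarrow> q \<in> adjoint_op ipH H0 \<Longrightarrow> \<Omega> p q = \<omega> (F p) (F q)"

end

theory Submission
  imports Defs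
begin

text \<open>
  Write \<open>T = H0\<^sup>*\<close>. The adjoint of a relation is its annihilator under the standard
  skew-symmetric form, so a self-adjoint relation is one that equals its own annihilator, and
  a self-adjoint operator is in addition densely defined. Two observations reduce the theorem
  to linear relations in the boundary space.

  First, \<open>F\<close> carries one skew-symmetric form to the other and is surjective, so it transports
  annihilators: the self-adjoint restrictions of \<open>T\<close> are exactly the preimages under \<open>F\<close> of
  self-adjoint relations \<open>M\<close> in \<open>\<G>\<close> (lemma \<open>self_adjoint_iff_preimage\<close>). That the
  annihilator of such a preimage does not leave \<open>T\<close> comes from \<open>H0\<close>, which lies in \<open>T\<close> by
  symmetry. Its elements annihilate \<open>T\<close>, hence \<open>F\<close> maps them to vectors annihilating all of
  \<open>\<G> \<oplus> \<G>\<close>, that is, to \<open>0\<close>. So \<open>H0\<close> lies in every preimage, which is therefore densely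
  defined, and the annihilator of the preimage lies in that of \<open>H0\<close>, which is \<open>T\<close>.

  Secondly, a self-adjoint relation \<open>M\<close> splits into an operator and a purely multivalued part.
  The values of \<open>M\<close> at \<open>0\<close> form the orthogonal complement of its domain, so with \<open>X\<close> the closure
  of the domain and \<open>Q\<close> the orthogonal projection onto \<open>X\<close>, the part \<open>L\<close> of \<open>M\<close> in \<open>X \<times> X\<close> is a
  self-adjoint operator, and \<open>(a, b) \<in> M\<close> says precisely that \<open>a \<in> D(L)\<close> and \<open>L a = Q b\<close>
  (lemmas \<open>self_adjoint_relation_operator_part\<close> and \<open>adjoint_op_lift\<close>). The one analytic
  ingredient is the projection theorem for closed subspaces, which is proved by the usual
  minimizing sequence argument.
\<close>

section \<open>Inner products over the reals or the complex numbers\<close>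

lemma conj_zero [simp]: "conj (0::'k::real_or_complex) = 0"
  using conj_add[of "0::'k" 0] by simp

text \<open>
  Off zero, conjugation is \<open>z \<mapsto> \<bar>z\<bar>\<^sup>2 / z\<close>, a formula that is visibly multiplicative.
\<close>

lemma conj_mult: "conj (x * y) = conj x * conj y" for x y :: "'k::real_or_complex"
proof (cases "x = 0 \<or> y = 0")
  case False
  have "(x * y) * conj (x * y) = (x * conj x) * (y * conj y)"
    by (simp add: mult_conj norm_mult power_mult_distrib)
  then have "(x * y) * conj (x * y) = (x * y) * (conj x * conj y)"
    by (simp add: mult_ac)
  with False show ?thesis by simp
qed auto

context hilbert_space
begin

lemma ip_add_right: "ip x (y + z) = ip x y + ip x z"
  by (metis conj_add ip_add_left ip_commute)

lemma ip_scale_right: "ip x (scale c y) = conj c * ip x y"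
  by (metis conj_mult ip_commute ip_scale_left)

lemma ip_zero_left [simp]: "ip 0 y = 0"
  using ip_add_left[of 0 0 y] by simp

lemma ip_zero_right [simp]: "ip x 0 = 0"
  using ip_add_right[of x 0 0] by simp

lemma ip_diff_left: "ip (x - y) z = ip x z - ip y z"
  using ip_add_left[of "x - y" y z] by simp

lemma ip_diff_right: "ip z (x - y) = ip z x - ip z y"
  using ip_add_right[of z "x - y" y] by simp

lemma ip_eq_zero_commute: "ip x y = 0 \<longleftrightarrow> ip y x = 0"
  by (metis conj_zero ip_commute)

lemma ip_self_eq_zero [simp]: "ip x x = 0 \<longleftrightarrow> x = 0"
proof -
  have "(of_real ((norm x)\<^sup>2) :: 'k) = of_real 0 \<longleftrightarrow> x = 0"
    by (subst of_real_eq_iff) simp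
  then show ?thesis by (simp only: norm_eq of_real_0)
qed

lemma pythagoras:
  assumes "ip x y = 0"
  shows "(norm (x + y))\<^sup>2 = (norm x)\<^sup>2 + (norm y)\<^sup>2"
proof -
  have "(of_real ((norm (x + y))\<^sup>2) :: 'k) = of_real ((norm x)\<^sup>2 + (norm y)\<^sup>2)"
    using assms ip_eq_zero_commute[of x y]
    by (simp only: norm_eq of_real_add) (simp add: ip_add_left ip_add_right)
  then show ?thesis by (simp only: of_real_eq_iff)
qed

lemma parallelogram:
  fixes x y :: 'v
  shows "(norm (x + y))\<^sup>2 + (norm (x - y))\<^sup>2 = 2 * (norm x)\<^sup>2 + 2 * (norm y)\<^sup>2"
proof -
  have "(of_real ((norm (x + y))\<^sup>2 + (norm (x - y))\<^sup>2) :: 'k)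
      = ip (x + y) (x + y) + ip (x - y) (x - y)"
    by (simp only: norm_eq of_real_add)
  also have "\<dots> = 2 * ip x x + 2 * ip y y"
    by (simp add: ip_add_left ip_add_right ip_diff_left ip_diff_right)
  also have "\<dots> = of_real (2 * (norm x)\<^sup>2 + 2 * (norm y)\<^sup>2)"
    by (simp only: norm_eq of_real_add of_real_mult of_real_numeral)
  finally show ?thesis by (simp only: of_real_eq_iff)
qed

lemma norm_scale: "norm (scale c x) = norm c * norm x"
proof -
  have "(of_real ((norm (scale c x))\<^sup>2) :: 'k) = (c * conj c) * ip x x"
    by (simp only: norm_eq) (simp add: ip_scale_left ip_scale_right)
  also have "\<dots> = of_real ((norm c * norm x)\<^sup>2)"
    by (simp add: mult_conj power_mult_distrib flip: norm_eq)
  finally have "(norm (scale c x))\<^sup>2 = (norm c * norm x)\<^sup>2"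
    by (simp only: of_real_eq_iff)
  then show ?thesis by simp
qed

lemma orthogonal_component:
  assumes "y \<noteq> 0"
  shows "ip (x - scale (ip x y / ip y y) y) y = 0"
  using assms by (simp add: ip_diff_left ip_scale_left)

text \<open>
  By Pythagoras, the component of \<open>x\<close> along \<open>y\<close> is no longer than \<open>x\<close>.
\<close>

lemma Cauchy_Schwarz_ip: "norm (ip x y) \<le> norm x * norm y"
proof (cases "y = 0")
  case False
  define c where "c = ip x y / ip y y"
  have "ip (x - scale c y) (scale c y) = 0"
    unfolding c_def by (simp add: ip_scale_right orthogonal_component[OF False])
  from pythagoras[OF this] have "(norm (scale c y))\<^sup>2 \<le> (norm x)\<^sup>2" by simp
  then have "norm c * norm y \<le> norm x" by (simp add: norm_scale)
  moreover have "norm c = norm (ip x y) / (norm y)\<^sup>2"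
    by (simp only: c_def norm_divide norm_of_real flip: norm_eq) simp
  ultimately have "norm (ip x y) / norm y \<le> norm x"
    using False by (simp add: power2_eq_square)
  then show ?thesis using False by (simp add: field_simps)
qed simp

lemma bounded_linear_ip_left: "bounded_linear (\<lambda>x. ip x y)"
proof
  show "ip (r *\<^sub>R x) y = r *\<^sub>R ip x y" for r x
    by (simp add: ip_scale_left scaleR_conv_of_real flip: scale_of_real)
  show "\<exists>K. \<forall>x. norm (ip x y) \<le> norm x * K"
    using Cauchy_Schwarz_ip by blast
qed (rule ip_add_left)

lemma bounded_linear_scale: "bounded_linear (scale c)"
proof
  show "scale c (r *\<^sub>R x) = r *\<^sub>R scale c x" for r x
    by (simp add: mult.commute flip: scale_of_real)
  show "\<exists>K. \<forall>x. norm (scale c x) \<le> norm x * K"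
    by (auto simp: norm_scale mult.commute)
qed (rule scale_right_distrib)

lemma ip_eq_zero_closure:
  assumes "\<And>x. x \<in> S \<Longrightarrow> ip x y = 0" and "x \<in> closure S"
  shows "ip x y = 0"
proof -
  have "closed {x. ip x y = 0}"
    by (intro closed_Collect_eq linear_continuous_on bounded_linear_ip_left continuous_on_const)
  then have "closure S \<subseteq> {x. ip x y = 0}"
    using assms(1) by (intro closure_minimal) auto
  with assms(2) show ?thesis by blast
qed

lemma subspace_closure:
  assumes "subspace S"
  shows "subspace (closure S)"
proof (rule subspaceI)
  show "0 \<in> closure S"
    using subspace_0[OF assms] closure_subset by blast
next
  fix x y assume "x \<in> closure S" "y \<in> closure S"
  then obtain f g where "\<And>n. f n \<in> S" "f \<longlonglongrightarrow> x" "\<And>n. g n \<in> S" "g \<longlonglongrightarrow> y"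
    unfolding closure_sequential by blast
  then show "x + y \<in> closure S"
    unfolding closure_sequential using tendsto_add subspace_add[OF assms]
    by (intro exI[of _ "\<lambda>n. f n + g n"]) blast
next
  fix c x assume "x \<in> closure S"
  then obtain f where f: "\<And>n. f n \<in> S" "f \<longlonglongrightarrow> x"
    unfolding closure_sequential by blast
  then show "scale c x \<in> closure S"
    unfolding closure_sequential
    using bounded_linear.tendsto[OF bounded_linear_scale] subspace_scale[OF assms]
    by (intro exI[of _ "\<lambda>n. scale c (f n)"]) blast
qed


section \<open>The projection theorem\<close>

text \<open>
  The parallelogram law bounds the distance of two points of \<open>X\<close> by how far they are from
  minimizing the distance to \<open>y\<close>, because their midpoint lies in \<open>X\<close> as well. Minimizing
  sequences are therefore Cauchy.
\<close>

lemma nearest_point_exists: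
  assumes X: "subspace X" "closed X"
  obtains p where "p \<in> X" "\<And>x. x \<in> X \<Longrightarrow> norm (y - p) \<le> norm (y - x)"
proof -
  define D where "D = (\<lambda>x. (norm (y - x))\<^sup>2) ` X"
  define d where "d = Inf D"
  have ne: "D \<noteq> {}" using subspace_0[OF X(1)] by (auto simp: D_def)
  have bdd: "bdd_below D" by (auto simp: D_def intro: bdd_belowI[of _ 0])
  have lower: "d \<le> (norm (y - x))\<^sup>2" if "x \<in> X" for x
    unfolding d_def using that bdd by (auto simp: D_def intro: cInf_lower)
  have "\<exists>x\<in>X. (norm (y - x))\<^sup>2 < d + inverse (real (Suc n))" for n
  proof -
    have "Inf D < d + inverse (real (Suc n))" by (simp add: d_def)
    from cInf_lessD[OF ne this] show ?thesis by (auto simp: D_def)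
  qed
  then obtain f where f: "\<And>n. f n \<in> X" "\<And>n. (norm (y - f n))\<^sup>2 < d + inverse (real (Suc n))"
    by metis
  have close: "(norm (a - b))\<^sup>2 \<le> 2 * ((norm (y - a))\<^sup>2 - d) + 2 * ((norm (y - b))\<^sup>2 - d)"
    if "a \<in> X" "b \<in> X" for a b
  proof -
    define m where "m = (1 / 2) *\<^sub>R (a + b)"
    have "m \<in> X"
      unfolding m_def scale_of_real[symmetric] using X(1) that
      by (intro subspace_scale subspace_add)
    have "(y - a) + (y - b) = 2 *\<^sub>R (y - m)"
      by (simp add: m_def scaleR_diff_right scaleR_2)
    then have "(norm ((y - a) + (y - b)))\<^sup>2 = 4 * (norm (y - m))\<^sup>2"
      by (simp add: power_mult_distrib)
    moreover have "norm ((y - a) - (y - b)) = norm (a - b)"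
      by (simp add: norm_minus_commute)
    ultimately show ?thesis
      using parallelogram[of "y - a" "y - b"] lower[OF \<open>m \<in> X\<close>] by simp
  qed
  have "Cauchy f"
  proof (rule metric_CauchyI)
    fix e :: real assume "e > 0"
    obtain N where N: "inverse (real (Suc N)) < e\<^sup>2 / 4"
      using reals_Archimedean[of "e\<^sup>2 / 4"] \<open>e > 0\<close> by auto
    have small: "(norm (y - f n))\<^sup>2 - d < e\<^sup>2 / 4" if "n \<ge> N" for n
    proof -
      have "inverse (real (Suc n)) \<le> inverse (real (Suc N))" using that by simp
      then show ?thesis using f(2)[of n] N by linarith
    qed
    show "\<exists>M. \<forall>m\<ge>M. \<forall>n\<ge>M. dist (f m) (f n) < e"
    proof (intro exI allI impI)
      fix m n assume "m \<ge> N" "n \<ge> N"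
      note close[OF f(1) f(1), of m n]
      also have "2 * ((norm (y - f m))\<^sup>2 - d) + 2 * ((norm (y - f n))\<^sup>2 - d)
          < 2 * (e\<^sup>2 / 4) + 2 * (e\<^sup>2 / 4)"
        by (intro add_strict_mono mult_strict_left_mono small \<open>m \<ge> N\<close> \<open>n \<ge> N\<close>) simp_all
      finally have "(norm (f m - f n))\<^sup>2 < e\<^sup>2" by simp
      then show "dist (f m) (f n) < e"
        using \<open>e > 0\<close> by (simp add: dist_norm power2_less_imp_less)
    qed
  qed
  then obtain p where p: "f \<longlonglongrightarrow> p" using Cauchy_convergent convergent_def by blast
  have "p \<in> X" using closed_sequentially[OF X(2) _ p] f(1) by blast
  have "(\<lambda>n. (norm (y - f n))\<^sup>2) \<longlonglongrightarrow> (norm (y - p))\<^sup>2"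
    by (intro tendsto_intros p)
  moreover have "(\<lambda>n. d + inverse (real (Suc n))) \<longlonglongrightarrow> d + 0"
    by (intro tendsto_intros LIMSEQ_inverse_real_of_nat)
  ultimately have p_le: "(norm (y - p))\<^sup>2 \<le> d + 0"
    by (rule LIMSEQ_le) (use f(2) less_imp_le in blast)
  have "norm (y - p) \<le> norm (y - x)" if "x \<in> X" for x
    by (rule power2_le_imp_le) (use p_le lower[OF that] in linarith, simp)
  with \<open>p \<in> X\<close> show ?thesis using that by blast
qed

text \<open>
  At a nearest point the residual is orthogonal to \<open>X\<close>: otherwise moving along its component
  in the direction of some \<open>x \<in> X\<close> would shorten it, by Pythagoras.
\<close>

lemma orthogonal_decomposition_exists:
  assumes X: "subspace X" "closed X"
  obtains p where "p \<in> X" "\<And>x. x \<in> X \<Longrightarrow> ip (y - p) x = 0"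
proof -
  obtain p where p: "p \<in> X" "\<And>x. x \<in> X \<Longrightarrow> norm (y - p) \<le> norm (y - x)"
    using nearest_point_exists[OF X] by blast
  have "ip (y - p) x = 0" if "x \<in> X" for x
  proof (cases "x = 0")
    case False
    define c where "c = ip (y - p) x / ip x x"
    define z where "z = y - p - scale c x"
    have "ip z (scale c x) = 0"
      unfolding z_def c_def by (simp add: ip_scale_right orthogonal_component[OF False])
    from pythagoras[OF this]
    have "(norm (y - p))\<^sup>2 = (norm z)\<^sup>2 + (norm (scale c x))\<^sup>2"
      by (simp add: z_def)
    moreover have "norm (y - p) \<le> norm z"
      using p(2)[of "p + scale c x"] X(1) p(1) that
      by (simp add: z_def subspace_add subspace_scale diff_diff_eq)
    then have "(norm (y - p))\<^sup>2 \<le> (norm z)\<^sup>2" by (intro power_mono) auto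
    ultimately have "scale c x = 0" by simp
    with False show ?thesis by (simp add: c_def)
  qed simp
  with p(1) show ?thesis using that by blast
qed

lemma orthogonal_projection_eqI:
  assumes "subspace X" "p \<in> X" "\<And>x. x \<in> X \<Longrightarrow> ip (y - p) x = 0"
  shows "orthogonal_projection ip X y = p"
  unfolding orthogonal_projection_def
proof (rule the_equality)
  show "p \<in> X \<and> (\<forall>x\<in>X. ip (y - p) x = 0)" using assms by blast
next
  fix q assume q: "q \<in> X \<and> (\<forall>x\<in>X. ip (y - q) x = 0)"
  have "p - q \<in> X" using assms q subspace_diff by blast
  then have "ip (y - q) (p - q) = 0" "ip (y - p) (p - q) = 0" using q assms(3) by auto
  then have "ip ((y - q) - (y - p)) (p - q) = 0" by (simp only: ip_diff_left[of "y - q"]) simp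
  then show "q = p" by simp
qed

context
  fixes X :: "'v set"
  assumes X: "subspace X" "closed X"
begin

lemma orthogonal_projection_mem: "orthogonal_projection ip X y \<in> X"
  and ip_residual_left: "x \<in> X \<Longrightarrow> ip (y - orthogonal_projection ip X y) x = 0"
  using orthogonal_decomposition_exists[OF X, of y] orthogonal_projection_eqI[OF X(1), of _ y]
  by metis+

lemma ip_projection_left: "x \<in> X \<Longrightarrow> ip (orthogonal_projection ip X y) x = ip y x"
  using ip_residual_left[of x y] by (simp add: ip_diff_left)

lemma ip_projection_right: "x \<in> X \<Longrightarrow> ip x (orthogonal_projection ip X y) = ip x y"
  by (metis ip_commute ip_projection_left)

end


section \<open>Self-adjoint relations\<close>

lemma adjoint_op_eq_annihilator:
  "adjoint_op ip A = {q. \<forall>p\<in>A. standard_skew_form ip p q = 0}"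
  by (fastforce simp: adjoint_in_def standard_skew_form_def)

lemma standard_skew_form_nondegenerate:
  assumes "\<And>q. standard_skew_form ip p q = 0"
  shows "p = 0"
proof (cases p)
  case (Pair x y)
  with assms[of "(0, x)"] assms[of "(y, 0)"] show ?thesis
    by (simp add: standard_skew_form_def zero_prod_def)
qed

lemma module_prod_scale: "module_prod scale scale"
  by unfold_locales

lemma subspace_adjoint_in:
  assumes "subspace X"
  shows "module.subspace (module_prod.scale scale scale) (adjoint_in ip X A)"
proof -
  interpret P: module_prod scale scale by (rule module_prod_scale)
  show ?thesis
  proof (rule P.p.subspaceI)
    show "0 \<in> adjoint_in ip X A"
      using subspace_0[OF assms] by (auto simp: adjoint_in_def zero_prod_def)
  next
    fix p q assume "p \<in> adjoint_in ip X A" "q \<in> adjoint_in ip X A"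
    then show "p + q \<in> adjoint_in ip X A"
      using subspace_add[OF assms] by (fastforce simp: adjoint_in_def ip_add_right)
  next
    fix c p assume "p \<in> adjoint_in ip X A"
    then show "P.scale c p \<in> adjoint_in ip X A"
      using subspace_scale[OF assms]
      by (fastforce simp: adjoint_in_def P.scale_def ip_scale_right)
  qed
qed

lemma single_valued_adjoint_in:
  assumes X: "subspace X" and dense: "densely_defined_in X A"
  shows "single_valued (adjoint_in ip X A)"
proof (rule single_valuedI)
  fix u v w assume vw: "(u, v) \<in> adjoint_in ip X A" "(u, w) \<in> adjoint_in ip X A"
  have "ip x (v - w) = 0" if x: "x \<in> Domain A" for x
    using x vw by (fastforce simp: adjoint_in_def ip_diff_right)
  moreover have "v - w \<in> X" using vw X subspace_diff by (auto simp: adjoint_in_def)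
  ultimately have "ip (v - w) (v - w) = 0"
    using dense ip_eq_zero_closure[of "Domain A" "v - w" "v - w"]
    unfolding densely_defined_in_def by blast
  then show "v = w" by simp
qed

lemma subspace_Domain:
  assumes "module.subspace (module_prod.scale scale scale) M"
  shows "subspace (Domain M)"
proof -
  interpret P: module_prod scale scale by (rule module_prod_scale)
  have "(x + x', y + y') \<in> M" if "(x, y) \<in> M" "(x', y') \<in> M" for x y x' y'
    using P.p.subspace_add[OF assms that] by simp
  moreover have "(scale c x, scale c y) \<in> M" if "(x, y) \<in> M" for c x y
    using P.p.subspace_scale[OF assms that, of c] by (simp add: P.scale_def)
  ultimately show ?thesis
    using P.p.subspace_0[OF assms]
    by (intro subspaceI) (auto simp: zero_prod_def Domain_iff, blast+)
qed

end

lemma op_apply_eq: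
  assumes "single_valued A" "(x, y) \<in> A"
  shows "op_apply A x = y"
  unfolding op_apply_def using assms by (auto dest: single_valuedD)

text \<open>
  For an operator \<open>L\<close> in \<open>X\<close> this is the orthogonal sum of \<open>L\<close> and the purely multivalued
  relation \<open>{0} \<times> X\<^sup>\<bottom>\<close>.
\<close>

definition lift_relation ::
  "('v::ab_group_add \<Rightarrow> 'v \<Rightarrow> 'k::zero) \<Rightarrow> 'v set \<Rightarrow> ('v \<times> 'v) set \<Rightarrow> ('v \<times> 'v) set" where
  "lift_relation ip X L =
     {(a, b). a \<in> Domain L \<and> op_apply L a = orthogonal_projection ip X b}"

lemma lift_relation_iff:
  assumes "single_valued L"
  shows "(a, b) \<in> lift_relation ip X L \<longleftrightarrow> (a, orthogonal_projection ip X b) \<in> L"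
  using op_apply_eq[OF assms] by (auto simp: lift_relation_def)

context hilbert_space
begin

text \<open>
  The relation contains \<open>(0, y)\<close> for every \<open>y\<close> orthogonal to \<open>X\<close>; this confines the domain of
  its adjoint to \<open>X\<close>, where the claim becomes the self-adjointness of \<open>L\<close>.
\<close>

lemma adjoint_op_lift:
  assumes X: "subspace X" "closed X"
    and L: "is_operator_in scale X L" "self_adjoint_in ip X L"
  shows "adjoint_op ip (lift_relation ip X L) = lift_relation ip X L"
proof -
  let ?Q = "orthogonal_projection ip X" and ?M = "lift_relation ip X L"
  note Q = orthogonal_projection_mem[OF X] ip_residual_left[OF X]
    ip_projection_left[OF X] ip_projection_right[OF X]
  have LX: "L \<subseteq> X \<times> X" and "single_valued L"
    using L(1) by (auto simp: is_operator_in_def)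
  note M_iff = lift_relation_iff[OF \<open>single_valued L\<close>]
  have L_adj: "L = adjoint_in ip X L" using L(2) by (simp add: self_adjoint_in_def)
  have QX: "?Q x = x" if "x \<in> X" for x
    using that by (intro orthogonal_projection_eqI X(1)) auto
  have L_sub: "L \<subseteq> ?M" using LX by (auto simp: M_iff QX)
  show ?thesis
  proof (intro equalityI subrelI)
    fix c d assume "(c, d) \<in> adjoint_op ip ?M"
    then have adj: "ip b c = ip a d" if "(a, b) \<in> ?M" for a b
      using that by (auto simp: adjoint_in_def)
    have "c \<in> X"
    proof -
      have "?Q (c - ?Q c) = 0"
        using Q by (intro orthogonal_projection_eqI X(1) subspace_0) auto
      moreover have "(0, 0) \<in> L"
        using subspace_0[OF X(1)] by (subst L_adj) (auto simp: adjoint_in_def)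
      ultimately have "(0, c - ?Q c) \<in> ?M" by (simp add: M_iff)
      then have "ip (c - ?Q c) c = 0" using adj by fastforce
      then have "ip (c - ?Q c) (c - ?Q c) = 0"
        using Q(1,2) by (simp add: ip_diff_right[of "c - ?Q c"])
      then have "c = ?Q c" by simp
      with Q(1) show ?thesis by metis
    qed
    have "ip y c = ip x (?Q d)" if "(x, y) \<in> L" for x y
    proof -
      have "(x, y) \<in> ?M" "x \<in> X" using that L_sub LX by auto
      then show ?thesis using adj Q(4) by simp
    qed
    then have "(c, ?Q d) \<in> L"
      using \<open>c \<in> X\<close> Q(1) by (subst L_adj) (auto simp: adjoint_in_def)
    then show "(c, d) \<in> ?M" by (simp add: M_iff)
  next
    fix c d assume "(c, d) \<in> ?M"
    then have cd: "(c, ?Q d) \<in> L" by (simp add: M_iff)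
    have "ip b c = ip a d" if "(a, b) \<in> ?M" for a b
    proof -
      have ab: "(a, ?Q b) \<in> L" using that by (simp add: M_iff)
      have "(c, ?Q d) \<in> adjoint_in ip X L" using cd L_adj by blast
      then have "ip (?Q b) c = ip a (?Q d)" using ab by (auto simp: adjoint_in_def)
      moreover have "a \<in> X" "c \<in> X" using ab cd LX by auto
      ultimately show ?thesis using Q(3,4) by simp
    qed
    then show "(c, d) \<in> adjoint_op ip ?M" by (auto simp: adjoint_in_def)
  qed
qed

text \<open>
  For \<open>M\<close> equal to its adjoint, \<open>(0, y) \<in> M\<close> says that \<open>y\<close> is orthogonal to the domain of \<open>M\<close>.
  So the second components of \<open>M\<close> may be changed freely by vectors orthogonal to \<open>X\<close>, and
  projecting them to \<open>X\<close> stays within \<open>M\<close>.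
\<close>

lemma self_adjoint_relation_operator_part:
  assumes M: "adjoint_op ip M = M"
  defines "X \<equiv> closure (Domain M)"
  defines "L \<equiv> M \<inter> (X \<times> X)"
  shows "subspace X" "closed X" "is_operator_in scale X L" "self_adjoint_in ip X L"
    and "M = lift_relation ip X L"
proof -
  let ?Q = "orthogonal_projection ip X"
  interpret P: module_prod scale scale by (rule module_prod_scale)
  have sub: "P.p.subspace M"
    using subspace_adjoint_in[OF subspace_UNIV, of M] M by simp
  show X: "subspace X" "closed X"
    using subspace_closure[OF subspace_Domain[OF sub]] by (simp_all add: X_def)
  note Q = orthogonal_projection_mem[OF X] ip_residual_left[OF X]
    ip_projection_left[OF X] ip_projection_right[OF X]
  have dom: "Domain M \<subseteq> X" unfolding X_def by (rule closure_subset)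
  have mul: "(0, y) \<in> M" if "\<And>x. x \<in> Domain M \<Longrightarrow> ip x y = 0" for y
    using that by (subst M[symmetric]) (auto simp: adjoint_in_def)
  have residual: "(0, b - ?Q b) \<in> M" for b
    using Q(2) dom by (intro mul) (auto simp: ip_eq_zero_commute[of _ "b - ?Q b"])
  have M_iff: "(a, b) \<in> M \<longleftrightarrow> (a, ?Q b) \<in> L" for a b
  proof
    assume ab: "(a, b) \<in> M"
    with P.p.subspace_diff[OF sub ab residual[of b]] dom Q(1)
    show "(a, ?Q b) \<in> L" by (auto simp: L_def)
  next
    assume "(a, ?Q b) \<in> L"
    then have "(a, ?Q b) \<in> M" by (simp add: L_def)
    with P.p.subspace_add[OF sub this residual[of b]] show "(a, b) \<in> M" by simp
  qed
  have "Domain M \<subseteq> Domain L" using M_iff by blast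
  then have dense: "densely_defined_in X L"
    unfolding densely_defined_in_def X_def by (intro closure_mono)
  have L_adj: "L = adjoint_in ip X L"
  proof (intro equalityI subrelI)
    fix u v assume "(u, v) \<in> L"
    then have "(u, v) \<in> X \<times> X" "(u, v) \<in> adjoint_op ip M" using M by (auto simp: L_def)
    then show "(u, v) \<in> adjoint_in ip X L" by (auto simp: adjoint_in_def L_def)
  next
    fix u v assume uv: "(u, v) \<in> adjoint_in ip X L"
    then have "u \<in> X" "v \<in> X" by (auto simp: adjoint_in_def)
    have "ip b u = ip a v" if "(a, b) \<in> M" for a b
    proof -
      have "(a, ?Q b) \<in> L" using that M_iff by simp
      then have "ip (?Q b) u = ip a v" using uv by (auto simp: adjoint_in_def)
      then show ?thesis using Q(3) \<open>u \<in> X\<close> by simp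
    qed
    then have "(u, v) \<in> adjoint_op ip M" by (auto simp: adjoint_in_def)
    then show "(u, v) \<in> L" using M \<open>u \<in> X\<close> \<open>v \<in> X\<close> by (simp add: L_def)
  qed
  show "self_adjoint_in ip X L" using dense L_adj by (simp add: self_adjoint_in_def)
  have sv: "single_valued L"
    using single_valued_adjoint_in[OF X(1) dense] L_adj by simp
  moreover have "P.p.subspace L" using subspace_adjoint_in[OF X(1), of L] L_adj by simp
  ultimately show "is_operator_in scale X L" by (auto simp: is_operator_in_def L_def)
  show "M = lift_relation ip X L"
    using M_iff by (auto simp: lift_relation_iff[OF sv])
qed

end


section \<open>Self-adjoint restrictions as preimages\<close>

text \<open>
  If \<open>H\<close> is self-adjoint, take \<open>M = F(H)\<close>. In both directions an annihilator in \<open>\<G> \<oplus> \<G>\<close> is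
  computed by pulling the vectors back along the surjection \<open>F\<close>.
\<close>

lemma self_adjoint_iff_preimage:
  assumes "boundary_system sH ipH sG ipG sG ipG H0
      (standard_skew_form ipH) F (standard_skew_form ipG)"
    and dense: "densely_defined H0" and sym: "symmetric_op ipH H0"
    and HT: "H \<subseteq> adjoint_op ipH H0"
  shows "self_adjoint ipH H \<longleftrightarrow>
    (\<exists>M. adjoint_op ipG M = M \<and> H = {p \<in> adjoint_op ipH H0. F p \<in> M})"
proof -
  interpret boundary_system sH ipH sG ipG sG ipG H0
    "standard_skew_form ipH" F "standard_skew_form ipG" by fact
  let ?T = "adjoint_op ipH H0"
  note annH = H.adjoint_op_eq_annihilator and annG = G1.adjoint_op_eq_annihilator
  show ?thesis
  proof
    assume "self_adjoint ipH H"
    then have H: "adjoint_op ipH H = H" by (simp add: self_adjoint_in_def)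
    have ann_iff: "q \<in> H \<longleftrightarrow> F q \<in> adjoint_op ipG (F ` H)" if "q \<in> ?T" for q
    proof -
      have "q \<in> H \<longleftrightarrow> (\<forall>p\<in>H. standard_skew_form ipH p q = 0)"
        by (subst H[symmetric]) (simp add: annH)
      also have "\<dots> \<longleftrightarrow> F q \<in> adjoint_op ipG (F ` H)"
        using \<Omega>_eq[OF _ that] HT by (auto simp: annG subset_iff)
      finally show ?thesis .
    qed
    have "adjoint_op ipG (F ` H) = F ` H"
    proof (intro equalityI subsetI)
      fix n assume n: "n \<in> adjoint_op ipG (F ` H)"
      moreover obtain q where "q \<in> ?T" "n = F q" using F_surj by (metis UNIV_I imageE)
      ultimately show "n \<in> F ` H" using ann_iff by blast
    next
      fix n assume "n \<in> F ` H"
      then show "n \<in> adjoint_op ipG (F ` H)" using ann_iff HT by blast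
    qed
    moreover from this have "H = {p \<in> ?T. F p \<in> F ` H}" using ann_iff HT by blast
    ultimately show "\<exists>M. adjoint_op ipG M = M \<and> H = {p \<in> ?T. F p \<in> M}" by blast
  next
    assume "\<exists>M. adjoint_op ipG M = M \<and> H = {p \<in> ?T. F p \<in> M}"
    then obtain M where M: "adjoint_op ipG M = M" and H: "H = {p \<in> ?T. F p \<in> M}" by blast
    have "0 \<in> M"
      by (subst M[symmetric]) (auto simp: adjoint_in_def zero_prod_def)
    have "H0 \<subseteq> H"
    proof
      fix p assume "p \<in> H0"
      then have "p \<in> ?T" using sym by (auto simp: symmetric_in_def)
      have "standard_skew_form ipG (F p) n = 0" for n
      proof -
        obtain q where q: "q \<in> ?T" "n = F q" using F_surj by (metis UNIV_I imageE)
        then have "standard_skew_form ipH p q = 0" using \<open>p \<in> H0\<close> by (simp add: annH)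
        then show ?thesis using \<Omega>_eq[OF \<open>p \<in> ?T\<close> q(1)] q(2) by simp
      qed
      then have "F p = 0" by (rule G1.standard_skew_form_nondegenerate)
      then show "p \<in> H" using \<open>p \<in> ?T\<close> \<open>0 \<in> M\<close> H by simp
    qed
    have "adjoint_op ipH H \<subseteq> ?T" using \<open>H0 \<subseteq> H\<close> by (auto simp: annH)
    have "F ` H = M"
    proof (intro equalityI subsetI)
      fix n assume "n \<in> M"
      moreover obtain q where "q \<in> ?T" "n = F q" using F_surj by (metis UNIV_I imageE)
      ultimately show "n \<in> F ` H" using H by blast
    qed (use H in auto)
    have ann_iff: "q \<in> adjoint_op ipH H \<longleftrightarrow> F q \<in> M" if "q \<in> ?T" for q
    proof -
      have "q \<in> adjoint_op ipH H \<longleftrightarrow> F q \<in> adjoint_op ipG (F ` H)"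
        using \<Omega>_eq[OF _ that] HT by (auto simp: annH annG subset_iff)
      then show ?thesis by (simp add: \<open>F ` H = M\<close> M)
    qed
    have "adjoint_op ipH H = H"
      using ann_iff \<open>adjoint_op ipH H \<subseteq> ?T\<close> H by blast
    moreover have "densely_defined H"
      using dense closure_mono[OF Domain_mono[OF \<open>H0 \<subseteq> H\<close>]]
      by (auto simp: densely_defined_in_def)
    ultimately show "self_adjoint ipH H" by (simp add: self_adjoint_in_def)
  qed
qed

text \<open>A restriction of an operator is determined by its domain.\<close>

lemma restriction_eq_iff_Domain_eq:
  assumes "single_valued T" "S \<subseteq> T"
  shows "S = {p \<in> T. P p} \<longleftrightarrow> Domain S = {x \<in> Domain T. P (x, op_apply T x)}"
proof -
  have T: "(x, op_apply T x) \<in> T" if "x \<in> Domain T" for x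
    using that op_apply_eq[OF assms(1)] by blast
  have S: "y = op_apply T x" if "(x, y) \<in> S" for x y
    using that op_apply_eq[OF assms(1)] assms(2) by blast
  show ?thesis
  proof
    assume "S = {p \<in> T. P p}"
    with T S show "Domain S = {x \<in> Domain T. P (x, op_apply T x)}" by fast
  next
    assume D: "Domain S = {x \<in> Domain T. P (x, op_apply T x)}"
    show "S = {p \<in> T. P p}"
    proof (intro equalityI subrelI)
      fix x y assume xy: "(x, y) \<in> S"
      then have "x \<in> Domain S" by (rule DomainI)
      then have "P (x, y)" using D S[OF xy] by simp
      then show "(x, y) \<in> {p \<in> T. P p}" using xy assms(2) by blast
    next
      fix x y assume "(x, y) \<in> {p \<in> T. P p}"
      then have xy: "(x, y) \<in> T" "P (x, y)" by simp_all
      have y: "op_apply T x = y" by (rule op_apply_eq[OF assms(1) xy(1)])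
      have "x \<in> Domain T" using xy(1) by (rule DomainI)
      then have "x \<in> Domain S" using D xy(2) y by simp
      then obtain z where z: "(x, z) \<in> S" by blast
      then show "(x, y) \<in> S" using S[OF z] y by simp
    qed
  qed
qed

theorem theorem2p2:
  fixes sH :: "'k::real_or_complex \<Rightarrow> 'h::banach \<Rightarrow> 'h" and ipH :: "'h \<Rightarrow> 'h \<Rightarrow> 'k"
    and sG :: "'k \<Rightarrow> 'g::banach \<Rightarrow> 'g" and ipG :: "'g \<Rightarrow> 'g \<Rightarrow> 'k"
    and H0 H :: "('h \<times> 'h) set"
    and F :: "'h \<times> 'h \<Rightarrow> 'g \<times> 'g"
    and F1 F2 :: "'h \<Rightarrow> 'g"
  assumes "hilbert_space sH ipH"
    and "hilbert_space sG ipG"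
    and "is_operator sH H0" and "densely_defined H0" and "symmetric_op ipH H0"
    and "boundary_system sH ipH sG ipG sG ipG H0
           (standard_skew_form ipH) F (standard_skew_form ipG)"
    and "\<And>x. x \<in> Domain (adjoint_op ipH H0) \<Longrightarrow>
           F (x, op_apply (adjoint_op ipH H0) x) = (F1 x, F2 x)"
    and "is_operator sH H" and "H \<subseteq> adjoint_op ipH H0"
  shows "self_adjoint ipH H \<longleftrightarrow>
    (\<exists>X L. module.subspace sG X \<and> closed X \<and>
       is_operator_in sG X L \<and> self_adjoint_in ipG X L \<and>
       Domain H = {x \<in> Domain (adjoint_op ipH H0).
         F1 x \<in> Domain L \<and> op_apply L (F1 x) = orthogonal_projection ipG X (F2 x)})"
proof -
  interpret H: hilbert_space sH ipH by fact
  interpret G: hilbert_space sG ipG by fact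
  let ?T = "adjoint_op ipH H0"
  have T: "single_valued ?T"
    using H.single_valued_adjoint_in[OF H.subspace_UNIV] assms(4) .
  have M_iff: "(\<exists>M. adjoint_op ipG M = M \<and> R M) \<longleftrightarrow>
      (\<exists>X L. G.subspace X \<and> closed X \<and> is_operator_in sG X L \<and> self_adjoint_in ipG X L \<and>
        R (lift_relation ipG X L))" for R
    using G.self_adjoint_relation_operator_part G.adjoint_op_lift by metis
  have dom_iff: "H = {p \<in> ?T. F p \<in> lift_relation ipG X L} \<longleftrightarrow>
      Domain H = {x \<in> Domain ?T.
        F1 x \<in> Domain L \<and> op_apply L (F1 x) = orthogonal_projection ipG X (F2 x)}" for X L
    unfolding restriction_eq_iff_Domain_eq[OF T assms(9)]
    by (simp add: assms(7) lift_relation_def cong: conj_cong)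
  show ?thesis
    unfolding self_adjoint_iff_preimage[OF assms(6,4,5,9)] M_iff dom_iff ..
qed

end
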